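(* Let $\mathcal{P}=(P,\leq)$ be a finite bounded poset which is EL-shellable, with EL-labeling $\lambda:\mathcal{E}(\mathcal{P})\to\Lambda$. Then for every integer $m>0$ the product labeling $\lambda^{m}$ (restricted to the cover relations of $\mathcal{P}^{[m]}$) is an EL-labeling of the poset of $m$-multichains $\mathcal{P}^{[m]}$.
   Context: Poset of multichains: for a finite poset $\mathcal{P}=(P,\leq)$ and an integer $m>0$, let $P^{[m]}=\{(x_1,\ldots,x_m)\in P^m\mid x_1\leq x_2\leq\cdots\leq x_m\}$, and let $\mathcal{P}^{[m]}=(P^{[m]},\leq)$ with the componentwise order. A poset is bounded if it has a unique minimal element $\hat 0$ and a unique maximal element $\hat 1$; if $\mathcal{P}$ is finite and bounded, so is $\mathcal{P}^{[m]}$. Write $x\lessdot y$ if $x<y$ and there is no $z$ with $x<z<y$, and let $\mathcal{E}(\mathcal{P})=\{(x,y)\mid x\lessdot y\}$. Edge-labelings: an edge-labeling of $\mathcal{P}$ is a map $\lambda:\mathcal{E}(\mathcal{P})\to\Lambda$, where $(\Lambda,\leq_\Lambda)$ is an arbitrary poset. A maximal chain $x_1\lessdot x_2\lessdot\cdots\lessdot x_s$ of an interval $[x,y]=\{z\mid x\leq z\leq y\}$ (so $x_1=x$, $x_s=y$) has label sequence $(\lambda(x_1,x_2),\lambda(x_2,x_3),\ldots,\lambda(x_{s-1},x_s))$; the chain is rising if its label sequence is strictly increasing with respect to $\leq_\Lambda$. Finite tuples over $\Lambda$ are compared lexicographically: $(k_1,\ldots,k_s)\leq_{\mathrm{lex}}(l_1,\ldots,l_t)$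 if and only if either $s\leq t$ and $k_i=l_i$ for all $i\leq s$, or $k_i<_\Lambda l_i$ for the least $i$ with $k_i\neq l_i$. One maximal chain precedes another if its label sequence is $\leq_{\mathrm{lex}}$ that of the other. An edge-labeling $\lambda$ of a bounded poset is an EL-labeling if for every interval $[x,y]$ (with $x\leq y$) there exists a unique rising maximal chain in $[x,y]$, and this chain precedes every other maximal chain of $[x,y]$. A bounded poset admitting an EL-labeling is called EL-shellable. Product labeling: adjoin to $\Lambda$ a formal symbol $\delta$ as a new least element. Two elements $\mathbf{x}=(x_1,\ldots,x_m)$ and $\mathbf{y}=(y_1,\ldots,y_m)$ of $P^{[m]}$ with $\mathbf{x}\lessdot\mathbf{y}$ in $\mathcal{P}^{[m]}$ differ in exactly one index $j$, and $x_j\lessdot y_j$ for this index. Define $\lambda^{m}(\mathbf{x},\mathbf{y})=(\delta,\ldots,\delta,\lambda(x_j,y_j),\delta,\ldots,\delta)\in(\Lambda\cup\{\delta\})^m$, with $\lambda(x_j,y_j)$ at position $j$. The label set $(\Lambda\cup\{\delta\})^m$ is ordered lexicographically, i.e. $(k_1,\ldots,k_m)<(l_1,\ldots,l_m)$ if and only if the tuples differ and $k_i<l_i$ in $\Lambda\cup\{\delta\}$ for the least $i$ with $k_i\neq l_i$. *)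

theory Defs
  imports Main "HOL-Library.FuncSet"
begin

text \<open>
  A poset is a carrier \<open>P\<close> with a weak order \<open>r\<close> such that \<^term>\<open>partial_order_on P r\<close>.
  Its strict order is \<^term>\<open>r - Id\<close>.
\<close>

definition bounded_poset :: "'a set \<Rightarrow> 'a rel \<Rightarrow> bool" where
  "bounded_poset P r \<longleftrightarrow>
     partial_order_on P r \<and>
     (\<exists>!b. b \<in> P \<and> (\<forall>x\<in>P. (x, b) \<in> r \<longrightarrow> x = b)) \<and>
     (\<exists>!t. t \<in> P \<and> (\<forall>x\<in>P. (t, x) \<in> r \<longrightarrow> x = t))"

definition covers :: "'a set \<Rightarrow> 'a rel \<Rightarrow> 'a rel" where
  "covers P r =
     {(x, y). x \<in> P \<and> y \<in> P \<and> (x, y) \<in> r - Id \<and>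
              \<not> (\<exists>z\<in>P. (x, z) \<in> r - Id \<and> (z, y) \<in> r - Id)}"

definition edge_labeling ::
    "'a set \<Rightarrow> 'a rel \<Rightarrow> 'l set \<Rightarrow> 'l rel \<Rightarrow> ('a \<times> 'a \<Rightarrow> 'l) \<Rightarrow> bool" where
  "edge_labeling P r \<Lambda> s lab \<longleftrightarrow> partial_order_on \<Lambda> s \<and> lab \<in> covers P r \<rightarrow> \<Lambda>"

definition maximal_chain :: "'a set \<Rightarrow> 'a rel \<Rightarrow> 'a \<Rightarrow> 'a \<Rightarrow> 'a list \<Rightarrow> bool" where
  "maximal_chain P r x y c \<longleftrightarrow>
     c \<noteq> [] \<and> set c \<subseteq> P \<and> hd c = x \<and> last c = y \<and>
     successively (\<lambda>u v. (u, v) \<in> covers P r) c"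

definition label_sequence :: "('a \<times> 'a \<Rightarrow> 'l) \<Rightarrow> 'a list \<Rightarrow> 'l list" where
  "label_sequence lab c = map lab (zip c (tl c))"

definition rising :: "'l rel \<Rightarrow> ('a \<times> 'a \<Rightarrow> 'l) \<Rightarrow> 'a list \<Rightarrow> bool" where
  "rising s lab c \<longleftrightarrow> successively (\<lambda>k l. (k, l) \<in> s - Id) (label_sequence lab c)"

text \<open>
  The library's \<^const>\<open>lexord\<close> of a strict order already makes a proper prefix smaller;
  the reflexive closure yields the weak lexicographic order on sequences of any lengths.
\<close>

definition lex_le :: "'l rel \<Rightarrow> 'l list rel" where
  "lex_le s = (lexord (s - Id))\<^sup>="

definition precedes :: "'l rel \<Rightarrow> ('a \<times> 'a \<Rightarrow> 'l) \<Rightarrow> 'a list \<Rightarrow> 'a list \<Rightarrow> bool" where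
  "precedes s lab c d \<longleftrightarrow> (label_sequence lab c, label_sequence lab d) \<in> lex_le s"

definition EL_labeling ::
    "'a set \<Rightarrow> 'a rel \<Rightarrow> 'l set \<Rightarrow> 'l rel \<Rightarrow> ('a \<times> 'a \<Rightarrow> 'l) \<Rightarrow> bool" where
  "EL_labeling P r \<Lambda> s lab \<longleftrightarrow>
     bounded_poset P r \<and> edge_labeling P r \<Lambda> s lab \<and>
     (\<forall>x y. (x, y) \<in> r \<longrightarrow>
        (\<exists>!c. maximal_chain P r x y c \<and> rising s lab c) \<and>
        (\<forall>c d. maximal_chain P r x y c \<and> rising s lab c \<and>
               maximal_chain P r x y d \<and> d \<noteq> c \<longrightarrow> precedes s lab c d))"

text \<open>An \<open>m\<close>-tuple is a list of length \<open>m\<close>, with positions counted from \<open>0\<close>.\<close>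

definition multichains :: "'a set \<Rightarrow> 'a rel \<Rightarrow> nat \<Rightarrow> 'a list set" where
  "multichains P r m =
     {xs. length xs = m \<and> set xs \<subseteq> P \<and> successively (\<lambda>x y. (x, y) \<in> r) xs}"

definition multichain_order :: "'a set \<Rightarrow> 'a rel \<Rightarrow> nat \<Rightarrow> 'a list rel" where
  "multichain_order P r m = Restr (listrel r) (multichains P r m)"

text \<open>The adjoined symbol \<open>\<delta>\<close> is \<^const>\<open>None\<close>.\<close>

definition adjoin_least :: "'l set \<Rightarrow> 'l option set" where
  "adjoin_least \<Lambda> = insert None (Some ` \<Lambda>)"

definition adjoin_least_order :: "'l set \<Rightarrow> 'l rel \<Rightarrow> 'l option rel" where
  "adjoin_least_order \<Lambda> s =
     {None} \<times> adjoin_least \<Lambda> \<union> {(Some k, Some l) | k l. (k, l) \<in> s}"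

definition label_tuples :: "'l set \<Rightarrow> nat \<Rightarrow> 'l option list set" where
  "label_tuples \<Lambda> m = {ks. length ks = m \<and> set ks \<subseteq> adjoin_least \<Lambda>}"

definition label_tuple_order :: "'l set \<Rightarrow> 'l rel \<Rightarrow> nat \<Rightarrow> 'l option list rel" where
  "label_tuple_order \<Lambda> s m = Restr (lex_le (adjoin_least_order \<Lambda> s)) (label_tuples \<Lambda> m)"

text \<open>
  Only meaningful when the two tuples differ in exactly one position, as they do along
  a cover relation of the multichain poset.
\<close>

definition product_labeling ::
    "nat \<Rightarrow> ('a \<times> 'a \<Rightarrow> 'l) \<Rightarrow> 'a list \<times> 'a list \<Rightarrow> 'l option list" where
  "product_labeling m lab =
     (\<lambda>(xs, ys). let j = (THE j. j < m \<and> xs ! j \<noteq> ys ! j)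
                 in (replicate m None)[j := Some (lab (xs ! j, ys ! j))])"

end

(* An edge-labeling of a finite bounded poset is an EL-labeling iff each interval [x, y] with
   x < y has a distinguished atom a(x, y) such that every other atom z has a larger label and,
   among the atoms z < y, the label of (x, z) is smaller than that of (z, a(z, y)) precisely for
   z = a(x, y). Here a(x, y) is the second element of the rising chain. In the poset of
   multichains, the distinguished atom of [x, y] replaces x_j by a(x_j, y_j) for the largest
   index j with x_j \<noteq> y_j: labels supported at smaller indices are lexicographically larger,
   and for labels at the same index the conditions are those of the original poset. *)
theory Submission
  imports Defs
begin

section \<open>Maximal chains and label sequences\<close>

lemma partial_orderD:
  assumes "partial_order_on P r"
  shows "\<And>x y. (x, y) \<in> r \<Longrightarrow> x \<in> P \<and> y \<in> P"
    and "\<And>x. x \<in> P \<Longrightarrow> (x, x) \<in> r"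
    and "\<And>x y z. (x, y) \<in> r \<Longrightarrow> (y, z) \<in> r \<Longrightarrow> (x, z) \<in> r"
    and "\<And>x y. (x, y) \<in> r \<Longrightarrow> (y, x) \<in> r \<Longrightarrow> x = y"
  using assms unfolding partial_order_on_def preorder_on_def
  by (auto simp: refl_on_def dest: antisymD transD)

lemma coversD:
  assumes "(x, y) \<in> covers P r"
  shows "x \<in> P" "y \<in> P" "(x, y) \<in> r" "x \<noteq> y"
  using assms unfolding covers_def by auto

lemma covers_eq:
  assumes "(x, y) \<in> covers P r" "(x, z) \<in> covers P r" "(z, y) \<in> r"
  shows "z = y"
  using assms unfolding covers_def by blast

lemma maximal_chain_Cons_Cons:
  "maximal_chain P r x y (u # v # c) \<longleftrightarrow>
     u = x \<and> (x, v) \<in> covers P r \<and> maximal_chain P r v y (v # c)"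
  unfolding maximal_chain_def by (auto dest: coversD)

lemma maximal_chain_singleton:
  "maximal_chain P r x y [u] \<longleftrightarrow> u = x \<and> u = y \<and> x \<in> P"
  unfolding maximal_chain_def by auto

lemma maximal_chain_neq_Nil: "\<not> maximal_chain P r x y []"
  unfolding maximal_chain_def by auto

lemma maximal_chain_le:
  assumes "partial_order_on P r" "maximal_chain P r x y c"
  shows "(x, y) \<in> r"
  using assms(2)
proof (induction c arbitrary: x)
  case Nil
  then show ?case by (simp add: maximal_chain_neq_Nil)
next
  case (Cons u c)
  show ?case
  proof (cases c)
    case Nil
    then show ?thesis
      using Cons.prems partial_orderD(2)[OF assms(1)] by (auto simp: maximal_chain_singleton)
  next
    case (Cons v d)
    then show ?thesis
      using Cons.prems Cons.IH[of v] partial_orderD(3)[OF assms(1)]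
      by (auto simp: maximal_chain_Cons_Cons dest: coversD)
  qed
qed

lemma maximal_chain_cases:
  assumes "partial_order_on P r" "maximal_chain P r x y c"
  obtains "x = y" "c = [x]"
  | z d where "c = x # z # d" "(x, z) \<in> covers P r" "(z, y) \<in> r" "x \<noteq> y"
      "maximal_chain P r z y (z # d)"
proof (cases c rule: remdups_adj.cases)
  case 1
  then show ?thesis using assms by (simp add: maximal_chain_neq_Nil)
next
  case (2 u)
  then show ?thesis using assms(2) that(1) by (auto simp: maximal_chain_singleton)
next
  case (3 u z d)
  then have z: "u = x" "(x, z) \<in> covers P r" "maximal_chain P r z y (z # d)"
    using assms(2) by (auto simp: maximal_chain_Cons_Cons)
  have "(z, y) \<in> r" using maximal_chain_le[OF assms(1) z(3)] .
  moreover have "x \<noteq> y"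
    using \<open>(z, y) \<in> r\<close> coversD[OF z(2)] partial_orderD(4)[OF assms(1)] by blast
  ultimately show ?thesis using that(2) z 3 by auto
qed

lemma label_sequence_simps [simp]:
  "label_sequence lab [x] = []"
  "label_sequence lab (x # y # c) = lab (x, y) # label_sequence lab (y # c)"
  unfolding label_sequence_def by auto

lemma rising_simps [simp]:
  "rising s lab [x]"
  "rising s lab [x, y]"
  "rising s lab (x # y # z # c) \<longleftrightarrow>
     (lab (x, y), lab (y, z)) \<in> s - Id \<and> rising s lab (y # z # c)"
  unfolding rising_def by auto

lemma rising_ConsD: "rising s lab (x # y # c) \<Longrightarrow> rising s lab (y # c)"
  by (cases c) auto

section \<open>A local criterion for EL-labelings\<close>

text \<open>The form is dictated by what a chain comparison sees. A strictly larger first label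
  already settles the lexicographic order, and prepending \<open>x\<close> to a rising chain of
  [z, y] keeps it rising iff the first two labels increase. The guard \<open>z \<noteq> y\<close> is
  there because \<open>a z y\<close> has meaning only for z < y.\<close>

definition rising_step ::
    "'a set \<Rightarrow> 'a rel \<Rightarrow> 'l rel \<Rightarrow> ('a \<times> 'a \<Rightarrow> 'l) \<Rightarrow> ('a \<Rightarrow> 'a \<Rightarrow> 'a) \<Rightarrow> bool" where
  "rising_step P r s lab a \<longleftrightarrow>
     (\<forall>x y. (x, y) \<in> r - Id \<longrightarrow>
        (x, a x y) \<in> covers P r \<and> (a x y, y) \<in> r \<and>
        (\<forall>z. (x, z) \<in> covers P r \<and> (z, y) \<in> r \<longrightarrow>
           (z \<noteq> a x y \<longrightarrow> (lab (x, a x y), lab (x, z)) \<in> s - Id) \<and>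
           (z \<noteq> y \<longrightarrow> ((lab (x, z), lab (z, a z y)) \<in> s - Id \<longleftrightarrow> z = a x y))))"

section \<open>From rising chains to distinguished atoms\<close>

text \<open>The delicate point is the strict label inequality, since minimality of the rising chain
  allows a tie in the first label. In a tie the second labels compare weakly, so the chain through
  \<open>z\<close> followed by the rising chain of [z, y] would rise as well, against
  uniqueness.\<close>

lemma EL_labeling_rising_step:
  assumes "EL_labeling P r \<Lambda> s lab"
  obtains a where "rising_step P r s lab a"
proof -
  have po: "partial_order_on P r" and spo: "partial_order_on \<Lambda> s"
    using assms unfolding EL_labeling_def bounded_poset_def edge_labeling_def by auto
  define C where "C x y = (THE c. maximal_chain P r x y c \<and> rising s lab c)" for x y
  \<comment> \<open>For x = y the chain is \<open>[y]\<close> and this value is unspecified; only x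
    < y matters.\<close>
  define a where "a x y = C x y ! 1" for x y
  have C: "maximal_chain P r x y (C x y) \<and> rising s lab (C x y)"
    and C_unique: "\<And>c. maximal_chain P r x y c \<Longrightarrow> rising s lab c \<Longrightarrow> c = C x y"
    and C_least: "\<And>d. maximal_chain P r x y d \<Longrightarrow> precedes s lab (C x y) d"
    if "(x, y) \<in> r" for x y
  proof -
    have ex: "\<exists>!c. maximal_chain P r x y c \<and> rising s lab c"
      using assms that unfolding EL_labeling_def by blast
    show C: "maximal_chain P r x y (C x y) \<and> rising s lab (C x y)"
      unfolding C_def by (rule theI'[OF ex])
    show "\<And>c. maximal_chain P r x y c \<Longrightarrow> rising s lab c \<Longrightarrow> c = C x y"
      using ex C by blast
    show "precedes s lab (C x y) d" if "maximal_chain P r x y d" for d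
    proof (cases "d = C x y")
      case True
      then show ?thesis by (simp add: precedes_def lex_le_def)
    next
      case False
      then show ?thesis using assms that C \<open>(x, y) \<in> r\<close> unfolding EL_labeling_def by blast
    qed
  qed
  have C_refl: "C y y = [y]" if "y \<in> P" for y
    using C_unique[of y y "[y]"] that partial_orderD(2)[OF po]
    by (simp add: maximal_chain_singleton)
  \<comment> \<open>The tail of a rising chain is rising, so by uniqueness it is the chosen chain of
    the upper interval.\<close>
  have step: "(x, a x y) \<in> covers P r \<and> (a x y, y) \<in> r \<and> C x y = x # C (a x y) y"
    if "(x, y) \<in> r" "x \<noteq> y" for x y
  proof -
    have "maximal_chain P r x y (C x y)" using C[OF that(1)] by blast
    from po this show ?thesis
    proof (cases rule: maximal_chain_cases)
      case 1
      then show ?thesis using that by simp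
    next
      case (2 z d)
      then have z: "z = a x y" by (simp add: a_def)
      have "rising s lab (z # d)" using C[OF that(1)] 2(1) rising_ConsD by metis
      then have "z # d = C z y" using C_unique 2 by blast
      then show ?thesis using 2 z by simp
    qed
  qed
  have C_eq: "C x y = x # tl (C x y)" if "(x, y) \<in> r" for x y
    using step[OF that] C_refl[of y] partial_orderD(1)[OF po that] by (cases "x = y") auto
  have strict_trans: "(k, n) \<in> s - Id" if "(k, l) \<in> s - Id" "(l, n) \<in> s" for k l n
    using that partial_orderD(3,4)[OF spo] by blast
  have atom_chain: "maximal_chain P r x y (x # C z y)"
    if "(x, z) \<in> covers P r" "(z, y) \<in> r" for x y z
    using C[OF that(2)] C_eq[OF that(2)] that(1) maximal_chain_Cons_Cons by metis
  \<comment> \<open>Uniqueness identifies such a chain with \<open>C x y\<close>, and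
    \<open>z\<close> is then its entry at index 1.\<close>
  have rising_eq: "z = a x y"
    if "(x, z) \<in> covers P r" "(z, y) \<in> r" "rising s lab (x # C z y)" for x y z
  proof -
    have "(x, y) \<in> r" using that partial_orderD(3)[OF po] coversD by metis
    then have "x # C z y = C x y" using C_unique atom_chain that by blast
    then show ?thesis
      unfolding a_def using C_eq[OF that(2)] by (metis nth_Cons_0 nth_Cons_Suc One_nat_def)
  qed
  have "rising_step P r s lab a"
    unfolding rising_step_def
  proof (intro allI impI)
    fix x y assume "(x, y) \<in> r - Id"
    then have xy: "(x, y) \<in> r" "x \<noteq> y" by auto
    note ax = step[OF xy]
    have "(z \<noteq> a x y \<longrightarrow> (lab (x, a x y), lab (x, z)) \<in> s - Id) \<and>
           (z \<noteq> y \<longrightarrow> ((lab (x, z), lab (z, a z y)) \<in> s - Id \<longleftrightarrow> z = a x y))"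
      if z: "(x, z) \<in> covers P r" "(z, y) \<in> r" for z
    proof (intro conjI impI)
      show "(lab (x, z), lab (z, a z y)) \<in> s - Id \<longleftrightarrow> z = a x y" if "z \<noteq> y"
      proof
        have "(a z y, y) \<in> r" and Cz: "C z y = z # C (a z y) y" using step[OF z(2) that] by auto
        then have "x # C z y = x # z # a z y # tl (C (a z y) y)" using C_eq by metis
        \<comment> \<open>\<open>C z y\<close> rises already, so only the comparison of the first
          two labels is open.\<close>
        then have iff: "rising s lab (x # C z y) \<longleftrightarrow> (lab (x, z), lab (z, a z y)) \<in> s - Id"
          using C[OF z(2)] Cz C_eq[OF \<open>(a z y, y) \<in> r\<close>] by (metis rising_simps(3))
        show "z = a x y" if "(lab (x, z), lab (z, a z y)) \<in> s - Id"
          using rising_eq[OF z] iff that by blast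
        show "(lab (x, z), lab (z, a z y)) \<in> s - Id" if "z = a x y"
          using iff C[OF xy(1)] ax that by simp
      qed
      assume ne: "z \<noteq> a x y"
      \<comment> \<open>If \<open>y\<close> covered \<open>x\<close>, it would be the only atom of
        [x, y]; two distinct atoms thus force both chains to have at least two labels.\<close>
      have "z \<noteq> y" using ne ax covers_eq z by metis
      have "a x y \<noteq> y" using ne ax covers_eq z by metis
      obtain L1 where L1: "label_sequence lab (C x y)
          = lab (x, a x y) # lab (a x y, a (a x y) y) # L1"
        using ax step[of "a x y" y] C_eq[of "a (a x y) y" y] \<open>a x y \<noteq> y\<close>
        by (metis label_sequence_simps(2))
      obtain L2 where L2: "label_sequence lab (x # C z y) = lab (x, z) # lab (z, a z y) # L2"
        using step[of z y] C_eq[of "a z y" y] z \<open>z \<noteq> y\<close> by (metis label_sequence_simps(2))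
      have up: "(lab (x, a x y), lab (a x y, a (a x y) y)) \<in> s - Id"
        using C[OF xy(1)] ax step[of "a x y" y] C_eq[of "a (a x y) y" y] \<open>a x y \<noteq> y\<close>
        by (metis rising_simps(3))
      have "(label_sequence lab (C x y), label_sequence lab (x # C z y)) \<in> lex_le s"
        using C_least[OF xy(1) atom_chain[OF z]] by (simp add: precedes_def)
      then consider "(lab (x, a x y), lab (x, z)) \<in> s - Id"
        | "lab (x, z) = lab (x, a x y)"
          "lab (a x y, a (a x y) y) = lab (z, a z y) \<or>
           (lab (a x y, a (a x y) y), lab (z, a z y)) \<in> s"
        unfolding L1 L2 lex_le_def by auto
      then show "(lab (x, a x y), lab (x, z)) \<in> s - Id"
      proof cases
        case 2
        then have "(lab (x, z), lab (z, a z y)) \<in> s - Id"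
          using up strict_trans by metis
        moreover have "x # C z y = x # z # a z y # tl (C (a z y) y)"
          using step[OF z(2) \<open>z \<noteq> y\<close>] C_eq by metis
        moreover have "C z y = z # a z y # tl (C (a z y) y)" using calculation(2) by simp
        ultimately have "rising s lab (x # C z y)" using C[OF z(2)] by simp
        then show ?thesis using rising_eq[OF z] ne by blast
      qed
    qed
    then show "(x, a x y) \<in> covers P r \<and> (a x y, y) \<in> r \<and>
        (\<forall>z. (x, z) \<in> covers P r \<and> (z, y) \<in> r \<longrightarrow>
           (z \<noteq> a x y \<longrightarrow> (lab (x, a x y), lab (x, z)) \<in> s - Id) \<and>
           (z \<noteq> y \<longrightarrow> ((lab (x, z), lab (z, a z y)) \<in> s - Id \<longleftrightarrow> z = a x y)))"
      using ax by blast
  qed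
  then show ?thesis using that by blast
qed

section \<open>From distinguished atoms to rising chains\<close>

lemma rising_step_EL_labeling:
  assumes "finite P" and bnd: "bounded_poset P r" and edge: "edge_labeling P r \<Lambda> s lab"
    and a: "rising_step P r s lab a"
  shows "EL_labeling P r \<Lambda> s lab"
proof -
  have po: "partial_order_on P r"
    using bnd unfolding bounded_poset_def by auto
  have "finite r"
    using \<open>finite P\<close> partial_orderD(1)[OF po] by (auto intro!: finite_subset[of r "P \<times> P"])
  \<comment> \<open>With the converse order the induction hypothesis concerns the elements strictly
    above \<open>x\<close>, while the upper endpoint stays fixed.\<close>
  then have "wf (r\<inverse> - Id)"
    using partial_order_on_well_order_on[of "r\<inverse>" P] po by simp
  have aD: "(x, a x y) \<in> covers P r" "(a x y, y) \<in> r"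
    if "(x, y) \<in> r" "x \<noteq> y" for x y
    using a that unfolding rising_step_def by auto
  have a_less: "(lab (x, a x y), lab (x, z)) \<in> s - Id"
    if "(x, z) \<in> covers P r" "(z, y) \<in> r" "z \<noteq> a x y" "(x, y) \<in> r" "x \<noteq> y" for x y z
    using a that unfolding rising_step_def by blast
  have a_rise: "(lab (x, z), lab (z, a z y)) \<in> s - Id \<longleftrightarrow> z = a x y"
    if "(x, z) \<in> covers P r" "(z, y) \<in> r" "z \<noteq> y" "(x, y) \<in> r" "x \<noteq> y" for x y z
    using a that unfolding rising_step_def by blast
  \<comment> \<open>Two strengthenings carry the induction: the second element of the chain is known
    to be \<open>a x y\<close>, so that \<open>a_rise\<close> applies one level down, and uniqueness
    is phrased as every other chain failing to rise.\<close>
  have main: "\<exists>c. maximal_chain P r x y c \<and> rising s lab c \<and>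
       (x \<noteq> y \<longrightarrow> (\<exists>d. c = x # a x y # d)) \<and>
       (\<forall>d. maximal_chain P r x y d \<and> d \<noteq> c \<longrightarrow> precedes s lab c d \<and> \<not> rising s lab d)"
    if "(x, y) \<in> r" for x y
    using \<open>wf (r\<inverse> - Id)\<close> that
  proof (induction x rule: wf_induct_rule)
    case (less x)
    show ?case
    proof (cases "x = y")
      case True
      have "d = [x]" if "maximal_chain P r x x d" for d
        using po that by (cases rule: maximal_chain_cases) auto
      then show ?thesis
        using True less.prems partial_orderD(1)[OF po]
        by (intro exI[of _ "[x]"]) (auto simp: maximal_chain_singleton)
    next
      case False
      note ax = aD[OF less.prems False]
      have IH: "\<exists>c. maximal_chain P r z y c \<and> rising s lab c \<and>
          (z \<noteq> y \<longrightarrow> (\<exists>d. c = z # a z y # d)) \<and>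
          (\<forall>d. maximal_chain P r z y d \<and> d \<noteq> c \<longrightarrow> precedes s lab c d \<and> \<not> rising s lab d)"
        if "(x, z) \<in> covers P r" "(z, y) \<in> r" for z
        using less.IH[of z] that coversD[OF that(1)] by auto
      obtain c where c: "maximal_chain P r (a x y) y c" "rising s lab c"
        "a x y \<noteq> y \<longrightarrow> (\<exists>d. c = a x y # a (a x y) y # d)"
        "\<And>d. maximal_chain P r (a x y) y d \<Longrightarrow> d \<noteq> c
            \<Longrightarrow> precedes s lab c d \<and> \<not> rising s lab d"
        using IH[OF ax] by blast
      obtain e where e: "c = a x y # e"
        using po c(1) by (cases rule: maximal_chain_cases) auto
      have "maximal_chain P r x y (x # c)"
        using c(1) ax(1) by (simp add: e maximal_chain_Cons_Cons)
      moreover have "rising s lab (x # c)"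
      proof (cases "a x y = y")
        case True
        have "c = [y]" using po c(1) by (cases rule: maximal_chain_cases) (auto simp: True)
        then show ?thesis by simp
      next
        case False
        then obtain f where f: "c = a x y # a (a x y) y # f" using c(3) by auto
        \<comment> \<open>For \<open>z = a x y\<close> the right-hand side of \<open>a_rise\<close>
          is trivially true.\<close>
        have "(lab (x, a x y), lab (a x y, a (a x y) y)) \<in> s - Id"
          using a_rise[OF ax False less.prems \<open>x \<noteq> y\<close>] by simp
        then show ?thesis using c(2) unfolding f by simp
      qed
      moreover have "\<exists>d. x # c = x # a x y # d" using e by simp
      moreover have "precedes s lab (x # c) d \<and> \<not> rising s lab d"
        if d: "maximal_chain P r x y d" "d \<noteq> x # c" for d
        using po d(1)
      proof (cases rule: maximal_chain_cases)
        case 1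
        then show ?thesis using False by simp
      next
        case (2 z g)
        \<comment> \<open>A competitor through \<open>a x y\<close> has the same first label and is
          handled by the induction hypothesis on tails; any other one loses at its first
          label.\<close>
        show ?thesis
        proof (cases "z = a x y")
          case True
          then have "precedes s lab c (z # g)" "\<not> rising s lab (z # g)"
            using c(4)[of "z # g"] 2 d(2) by auto
          then show ?thesis
            using 2(1) True rising_ConsD[of s lab x z g]
            by (auto simp: e precedes_def lex_le_def)
        next
          case ne: False
          have "(lab (x, a x y), lab (x, z)) \<in> s - Id"
            using a_less[OF 2(2,3) ne less.prems False] .
          moreover have "\<not> rising s lab d"
          proof
            assume "rising s lab d"
            then have zg: "rising s lab (z # g)" using 2(1) rising_ConsD by metis
            have "z \<noteq> y" using covers_eq[of x z P r "a x y"] 2(2) ax ne by auto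
            \<comment> \<open>A rising tail must be the chain given by the induction hypothesis,
              hence continues with \<open>a z y\<close>.\<close>
            then obtain h where "z # g = z # a z y # h"
              using IH[OF 2(2,3)] zg 2(5) by metis
            then have "(lab (x, z), lab (z, a z y)) \<in> s - Id"
              using \<open>rising s lab d\<close> 2(1) by simp
            then show False using a_rise[OF 2(2,3) \<open>z \<noteq> y\<close> less.prems False] ne by simp
          qed
          ultimately show ?thesis by (simp add: 2(1) e precedes_def lex_le_def)
        qed
      qed
      ultimately show ?thesis by blast
    qed
  qed
  show ?thesis
    unfolding EL_labeling_def
  proof (intro conjI allI impI bnd edge)
    fix x y assume "(x, y) \<in> r"
    note m = main[OF this]
    show "\<exists>!c. maximal_chain P r x y c \<and> rising s lab c" using m by metis
    show "precedes s lab c d" if "maximal_chain P r x y c \<and> rising s lab c \<and>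
      maximal_chain P r x y d \<and> d \<noteq> c" for c d using m that by metis
  qed
qed

section \<open>The poset of multichains\<close>

text \<open>Transitivity extends the comparison of neighbours to all pairs of positions, which makes
  changing a single entry easy to check.\<close>

lemma multichains_iff:
  assumes "partial_order_on P r"
  shows "xs \<in> multichains P r m \<longleftrightarrow>
    length xs = m \<and> (\<forall>i<m. xs ! i \<in> P) \<and> (\<forall>i j. i < j \<and> j < m \<longrightarrow> (xs ! i, xs ! j) \<in> r)"
proof -
  have "transp (\<lambda>x y. (x, y) \<in> r)"
    using partial_orderD(3)[OF assms] unfolding transp_def by blast
  then show ?thesis
    unfolding multichains_def
    by (auto simp: successively_conv_sorted_wrt sorted_wrt_iff_nth_less subset_iff in_set_conv_nth)
qed

lemma multichain_order_iff:
  assumes "partial_order_on P r"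
  shows "(xs, ys) \<in> multichain_order P r m \<longleftrightarrow>
    xs \<in> multichains P r m \<and> ys \<in> multichains P r m \<and> (\<forall>i<m. (xs ! i, ys ! i) \<in> r)"
  unfolding multichain_order_def multichains_def by (auto simp: listrel_iff_nth)

lemma multichain_eqI:
  assumes "xs \<in> multichains P r m" "ys \<in> multichains P r m" "\<And>i. i < m \<Longrightarrow> xs ! i = ys ! i"
  shows "xs = ys"
  using assms by (auto simp: multichains_def intro: nth_equalityI)

lemma partial_order_on_multichains:
  assumes "partial_order_on P r"
  shows "partial_order_on (multichains P r m) (multichain_order P r m)"
proof -
  note iff = multichain_order_iff[OF assms]
  note po = partial_orderD[OF assms]
  show ?thesis
    unfolding partial_order_on_def preorder_on_def
  proof (intro conjI)
    show "multichain_order P r m \<subseteq> multichains P r m \<times> multichains P r m"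
      unfolding multichain_order_def by auto
    show "refl_on (multichains P r m) (multichain_order P r m)"
      using po(2) by (auto simp: refl_on_def iff multichains_iff[OF assms])
    show "trans (multichain_order P r m)"
      unfolding trans_def using iff po(3) by meson
    show "antisym (multichain_order P r m)"
      unfolding antisym_def using iff po(4) multichain_eqI by meson
  qed
qed

lemma finite_multichains: "finite P \<Longrightarrow> finite (multichains P r m)"
  by (rule finite_subset[OF _ finite_lists_length_eq[of P m]]) (auto simp: multichains_def)

section \<open>Boundedness of the multichain poset\<close>

text \<open>Finiteness provides a minimal element among those below \<open>x\<close>. It is minimal
  in all of \<open>P\<close>, hence equal to \<open>b\<close>.\<close>

lemma unique_minimal_least:
  assumes "finite P" "partial_order_on P r"
    and b: "\<And>z. z \<in> P \<Longrightarrow> (\<forall>x\<in>P. (x, z) \<in> r \<longrightarrow> x = z) \<Longrightarrow> z = b"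
    and "x \<in> P"
  shows "(b, x) \<in> r"
proof -
  note po = partial_orderD[OF assms(2)]
  have "finite r"
    using assms(1) po(1) by (auto intro!: finite_subset[of r "P \<times> P"])
  then have "wf (r - Id)" using partial_order_on_well_order_on assms(2) by blast
  moreover have "x \<in> {z \<in> P. (z, x) \<in> r}" using assms po(2) by blast
  ultimately obtain z where z: "z \<in> P" "(z, x) \<in> r"
    and min: "\<And>w. (w, z) \<in> r - Id \<Longrightarrow> w \<notin> {z \<in> P. (z, x) \<in> r}"
    by (rule wfE_min) blast
  have "z = b"
    using min po(3) z by (intro b) blast+
  then show ?thesis using z by simp
qed

lemma bounded_posetE:
  assumes "finite P" "bounded_poset P r"
  obtains b t where "b \<in> P" "t \<in> P" "\<And>x. x \<in> P \<Longrightarrow> (b, x) \<in> r \<and> (x, t) \<in> r"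
proof -
  have po: "partial_order_on P r" using assms unfolding bounded_poset_def by blast
  obtain b where b: "b \<in> P" "\<And>z. z \<in> P \<Longrightarrow> (\<forall>x\<in>P. (x, z) \<in> r \<longrightarrow> x = z) \<Longrightarrow> z = b"
    using assms unfolding bounded_poset_def by metis
  obtain t where t: "t \<in> P" "\<And>z. z \<in> P \<Longrightarrow> (\<forall>x\<in>P. (z, x) \<in> r \<longrightarrow> x = z) \<Longrightarrow> z = t"
    using assms unfolding bounded_poset_def by metis
  \<comment> \<open>The greatest element is the least element of the converse order.\<close>
  show ?thesis
    using that[OF b(1) t(1)] unique_minimal_least[OF assms(1) po b(2)]
      unique_minimal_least[of P "r\<inverse>" t] assms(1) po t(2) by simp
qed

lemma bounded_posetI:
  assumes "partial_order_on P r" "b \<in> P" "t \<in> P" "\<And>x. x \<in> P \<Longrightarrow> (b, x) \<in> r \<and> (x, t) \<in> r"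
  shows "bounded_poset P r"
  unfolding bounded_poset_def
proof (intro conjI)
  show "\<exists>!b. b \<in> P \<and> (\<forall>x\<in>P. (x, b) \<in> r \<longrightarrow> x = b)"
    using assms partial_orderD(4)[OF assms(1)] by (intro ex1I[of _ b]) blast+
  show "\<exists>!t. t \<in> P \<and> (\<forall>x\<in>P. (t, x) \<in> r \<longrightarrow> x = t)"
    using assms partial_orderD(4)[OF assms(1)] by (intro ex1I[of _ t]) blast+
qed (fact assms(1))

text \<open>The constant tuples at the two bounds of \<open>P\<close> are the bounds.\<close>

lemma bounded_poset_multichains:
  assumes "finite P" "bounded_poset P r"
  shows "bounded_poset (multichains P r m) (multichain_order P r m)"
proof -
  have po: "partial_order_on P r" using assms unfolding bounded_poset_def by blast
  obtain b t where bt: "b \<in> P" "t \<in> P" "\<And>x. x \<in> P \<Longrightarrow> (b, x) \<in> r \<and> (x, t) \<in> r"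
    using bounded_posetE[OF assms] by blast
  have rep: "replicate m u \<in> multichains P r m" if "u \<in> P" for u
    using that partial_orderD(2)[OF po] by (simp add: multichains_iff[OF po])
  show ?thesis
    using bt rep
    by (intro bounded_posetI[OF partial_order_on_multichains[OF po],
          of "replicate m b" _ "replicate m t"])
       (auto simp: multichain_order_iff[OF po] multichains_iff[OF po])
qed

section \<open>Cover relations between multichains\<close>

text \<open>A tuple in between agrees with \<open>xs\<close> off position \<open>j\<close> by
  antisymmetry, and at \<open>j\<close> the cover relation of \<open>P\<close> leaves only the two
  end values.\<close>

lemma covers_multichains_update:
  assumes po: "partial_order_on P r" and j: "j < m"
    and xs: "xs \<in> multichains P r m" "xs[j := v] \<in> multichains P r m"
    and v: "(xs ! j, v) \<in> covers P r"
  shows "(xs, xs[j := v]) \<in> covers (multichains P r m) (multichain_order P r m)"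
proof -
  note iff = multichain_order_iff[OF po]
  have len: "length xs = m" using xs(1) by (simp add: multichains_def)
  have "(xs ! i, xs[j := v] ! i) \<in> r" if "i < m" for i
    using that xs(1) coversD(3)[OF v] partial_orderD(2)[OF po]
    by (cases "i = j") (auto simp: multichains_iff[OF po])
  then have le: "(xs, xs[j := v]) \<in> multichain_order P r m"
    using xs by (simp add: iff)
  have "xs \<noteq> xs[j := v]"
    using coversD(4)[OF v] j len by (metis nth_list_update_eq)
  moreover have "w = xs \<or> w = xs[j := v]"
    if w: "(xs, w) \<in> multichain_order P r m" "(w, xs[j := v]) \<in> multichain_order P r m" for w
  proof -
    have W: "w \<in> multichains P r m" using w iff by blast
    have other: "w ! i = xs ! i" if "i < m" "i \<noteq> j" for i
      using w that partial_orderD(4)[OF po] unfolding iff by (metis nth_list_update_neq)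
    have "(xs ! j, w ! j) \<in> r" "(w ! j, v) \<in> r"
      using w j len unfolding iff by (auto dest!: spec[of _ j])
    moreover have "w ! j \<in> P" using calculation(1) partial_orderD(1)[OF po] by blast
    ultimately have "w ! j = xs ! j \<or> w ! j = v"
      using v unfolding covers_def by auto
    then show ?thesis
    proof
      assume "w ! j = xs ! j"
      then have "w = xs" using other by (intro multichain_eqI[OF W xs(1)]) metis
      then show ?thesis ..
    next
      assume "w ! j = v"
      then have "w ! i = xs[j := v] ! i" if "i < m" for i
        using other that len by (cases "i = j") auto
      then have "w = xs[j := v]" by (rule multichain_eqI[OF W xs(2)])
      then show ?thesis ..
    qed
  qed
  ultimately show ?thesis using le xs unfolding covers_def by blast
qed

lemma last_difference:
  assumes "xs \<in> multichains P r m" "ys \<in> multichains P r m" "xs \<noteq> ys"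
  obtains j where "j < m" "xs ! j \<noteq> ys ! j" "\<And>i. j < i \<Longrightarrow> i < m \<Longrightarrow> xs ! i = ys ! i"
proof -
  let ?D = "{i. i < m \<and> xs ! i \<noteq> ys ! i}"
  have "finite ?D" by simp
  moreover have "?D \<noteq> {}" using multichain_eqI[OF assms(1,2)] assms(3) by blast
  ultimately have "Max ?D \<in> ?D" "\<And>i. i \<in> ?D \<Longrightarrow> i \<le> Max ?D"
    using Max_in[of ?D] Max_ge[of ?D] by blast+
  then show ?thesis using that[of "Max ?D"] by (metis (mono_tags, lifting) mem_Collect_eq not_le)
qed

text \<open>Raising an entry could break its comparison with later entries. Beyond the last
  difference these equal those of \<open>ys\<close>, so v \<le> \<open>ys ! j\<close> \<le>
  \<open>ys ! k\<close> = \<open>xs ! k\<close>.\<close>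

lemma update_last_difference:
  assumes po: "partial_order_on P r" and xy: "(xs, ys) \<in> multichain_order P r m"
    and j: "j < m" "\<And>i. j < i \<Longrightarrow> i < m \<Longrightarrow> xs ! i = ys ! i"
    and v: "(xs ! j, v) \<in> r" "(v, ys ! j) \<in> r"
  shows "xs[j := v] \<in> multichains P r m" "(xs[j := v], ys) \<in> multichain_order P r m"
proof -
  note mc = multichains_iff[OF po]
  note D = partial_orderD[OF po]
  have X: "xs \<in> multichains P r m" and Y: "ys \<in> multichains P r m"
    and le: "\<And>i. i < m \<Longrightarrow> (xs ! i, ys ! i) \<in> r"
    using xy by (auto simp: multichain_order_iff[OF po])
  have len: "length xs = m" using X mc by simp
  have "(xs[j := v] ! i, xs[j := v] ! k) \<in> r" if "i < k" "k < m" for i k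
  proof -
    consider "i \<noteq> j" "k \<noteq> j" | "k = j" | "i = j" by blast
    then show ?thesis
    proof cases
      case 1
      then show ?thesis using X that mc by simp
    next
      case 2
      then have "(xs ! i, xs ! j) \<in> r" using X that mc by simp
      then show ?thesis using 2 that len D(3)[OF _ v(1)] by simp
    next
      case 3
      then have "(ys ! j, xs ! k) \<in> r" using Y that mc j(2) by simp
      then show ?thesis using 3 that len j(1) D(3)[OF v(2)] by simp
    qed
  qed
  moreover have "xs[j := v] ! i \<in> P" if "i < m" for i
    using that X D(1)[OF v(1)] mc by (cases "i = j") auto
  ultimately show mem: "xs[j := v] \<in> multichains P r m" using len mc by simp
  have "(xs[j := v] ! i, ys ! i) \<in> r" if "i < m" for i
    using that le v(2) len by (cases "i = j") auto
  then show "(xs[j := v], ys) \<in> multichain_order P r m"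
    using mem Y by (simp add: multichain_order_iff[OF po])
qed

text \<open>Raising the last differing entry to an atom of its interval in \<open>P\<close> gives a
  multichain strictly above \<open>xs\<close> and still below \<open>ys\<close>; as
  \<open>ys\<close> covers \<open>xs\<close>, it must be \<open>ys\<close>.\<close>

lemma covers_multichainsE:
  assumes po: "partial_order_on P r"
    and a: "\<And>x y. (x, y) \<in> r \<Longrightarrow> x \<noteq> y \<Longrightarrow> (x, a x y) \<in> covers P r \<and> (a x y, y) \<in> r"
    and cov: "(xs, ys) \<in> covers (multichains P r m) (multichain_order P r m)"
  obtains j v where "j < m" "(xs ! j, v) \<in> covers P r" "ys = xs[j := v]"
proof -
  have xy: "(xs, ys) \<in> multichain_order P r m" "xs \<noteq> ys" using coversD[OF cov] by auto
  then have X: "xs \<in> multichains P r m" and Y: "ys \<in> multichains P r m"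
    and le: "\<And>i. i < m \<Longrightarrow> (xs ! i, ys ! i) \<in> r"
    by (auto simp: multichain_order_iff[OF po])
  obtain j where j: "j < m" "xs ! j \<noteq> ys ! j" "\<And>i. j < i \<Longrightarrow> i < m \<Longrightarrow> xs ! i = ys ! i"
    using last_difference[OF X Y xy(2)] by blast
  define v where "v = a (xs ! j) (ys ! j)"
  have v: "(xs ! j, v) \<in> covers P r" "(v, ys ! j) \<in> r"
    using a[OF le[OF j(1)] j(2)] unfolding v_def by auto
  note up = update_last_difference[OF po xy(1) j(1,3) coversD(3)[OF v(1)] v(2)]
  have "xs[j := v] = ys"
    using covers_eq[OF cov covers_multichains_update[OF po j(1) X up(1) v(1)] up(2)] .
  then show ?thesis using that[OF j(1) v(1)] by simp
qed

section \<open>The product labeling\<close>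

lemma partial_order_on_adjoin_least:
  assumes "partial_order_on \<Lambda> s"
  shows "partial_order_on (adjoin_least \<Lambda>) (adjoin_least_order \<Lambda> s)"
proof -
  note D = partial_orderD[OF assms]
  show ?thesis
    unfolding partial_order_on_def preorder_on_def
  proof (intro conjI)
    show "adjoin_least_order \<Lambda> s \<subseteq> adjoin_least \<Lambda> \<times> adjoin_least \<Lambda>"
      using D(1) by (auto simp: adjoin_least_order_def adjoin_least_def)
    show "refl_on (adjoin_least \<Lambda>) (adjoin_least_order \<Lambda> s)"
      using D(2) by (auto simp: refl_on_def adjoin_least_order_def adjoin_least_def)
    show "trans (adjoin_least_order \<Lambda> s)"
    proof (rule transI)
      fix k l n
      assume "(k, l) \<in> adjoin_least_order \<Lambda> s" "(l, n) \<in> adjoin_least_order \<Lambda> s"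
      then show "(k, n) \<in> adjoin_least_order \<Lambda> s"
        \<comment> \<open>\<open>the\<close> strips \<open>Some\<close>. The first fact puts
          \<open>n\<close> into the label set when \<open>k\<close> is \<open>None\<close>; the
          second is transitivity of \<open>s\<close> when no label is \<open>None\<close>.\<close>
        using D(1)[of "the l" "the n"] D(3)[of "the k" "the l" "the n"]
        by (auto simp: adjoin_least_order_def adjoin_least_def)
    qed
    show "antisym (adjoin_least_order \<Lambda> s)"
      using D(4) by (auto simp: antisym_def adjoin_least_order_def)
  qed
qed

lemma partial_order_on_lex_le:
  assumes "partial_order_on A s"
  shows "partial_order_on B (Restr (lex_le s) B)"
proof -
  have tr: "trans (s - Id)"
    using assms trans_diff_Id unfolding partial_order_on_def preorder_on_def by blast
  have irr: "(xs, xs) \<notin> lexord (s - Id)" for xs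
    by (rule lexord_irreflexive) simp
  show ?thesis
    unfolding partial_order_on_def preorder_on_def
  proof (intro conjI)
    show "refl_on B (Restr (lex_le s) B)" by (auto simp: refl_on_def lex_le_def)
    show "trans (Restr (lex_le s) B)"
      unfolding trans_def lex_le_def using lexord_trans[OF _ _ tr] by blast
    show "antisym (Restr (lex_le s) B)"
      unfolding antisym_def lex_le_def using lexord_trans[OF _ _ tr] irr by blast
  qed auto
qed

section \<open>Comparison of product labels\<close>

text \<open>Labels of covers all have this shape; naming it frees later arguments from the definite
  description in \<open>product_labeling\<close>.\<close>

definition label_at :: "nat \<Rightarrow> nat \<Rightarrow> 'l \<Rightarrow> 'l option list" where
  "label_at m j k = (replicate m None)[j := Some k]"

lemma label_at_nth: "i < m \<Longrightarrow> label_at m j k ! i = (if i = j then Some k else None)"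
  by (simp add: label_at_def nth_list_update)

lemma label_at_mem: "k \<in> \<Lambda> \<Longrightarrow> label_at m j k \<in> label_tuples \<Lambda> m"
  using set_update_subset_insert[of "replicate m None" j "Some k"]
  by (auto simp: label_at_def label_tuples_def adjoin_least_def split: if_splits)

lemma product_labeling_update:
  assumes "length xs = m" "j < m" "xs ! j \<noteq> v"
  shows "product_labeling m lab (xs, xs[j := v]) = label_at m j (lab (xs ! j, v))"
proof -
  have "(THE i. i < m \<and> xs ! i \<noteq> xs[j := v] ! i) = j"
    using assms by (intro the_equality) (auto simp: nth_list_update split: if_splits)
  then show ?thesis using assms by (simp add: product_labeling_def label_at_def)
qed

text \<open>The tuples first differ at the smaller of two distinct support positions, where the one
  supported later still has the least entry \<open>None\<close>. A common position leaves the
  comparison to \<open>s\<close>.\<close>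

lemma label_at_less_iff:
  assumes "i < m" "j < m" "k \<in> \<Lambda>" "l \<in> \<Lambda>"
  shows "(label_at m i k, label_at m j l) \<in> label_tuple_order \<Lambda> s m - Id \<longleftrightarrow>
    j < i \<or> i = j \<and> (k, l) \<in> s - Id"
proof -
  let ?k = "label_at m i k" and ?l = "label_at m j l" and ?o = "adjoin_least_order \<Lambda> s - Id"
  have len: "length (label_at m i x) = m" for i and x :: 'l by (simp add: label_at_def)
  have irr: "(xs, xs) \<notin> lexord ?o" for xs by (rule lexord_irreflexive) simp
  have "(?k, ?l) \<in> label_tuple_order \<Lambda> s m - Id \<longleftrightarrow> (?k, ?l) \<in> lexord ?o"
    using irr label_at_mem[OF assms(3)] label_at_mem[OF assms(4)]
    unfolding label_tuple_order_def lex_le_def by auto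
  \<comment> \<open>Both lists have length \<open>m\<close>, so the proper-prefix case of
    \<open>lexord\<close> cannot occur.\<close>
  also have "\<dots> \<longleftrightarrow> (\<exists>n<m. (\<forall>p<n. ?k ! p = ?l ! p) \<and> (?k ! n, ?l ! n) \<in> ?o)"
    unfolding lexord_take_index_conv len
    by (auto simp: len nth_take_lemma list_eq_iff_nth_eq)
  also have "\<dots> \<longleftrightarrow> j < i \<or> i = j \<and> (k, l) \<in> s - Id"
  proof
    assume "\<exists>n<m. (\<forall>p<n. ?k ! p = ?l ! p) \<and> (?k ! n, ?l ! n) \<in> ?o"
    then obtain n where n: "n < m" "\<forall>p<n. ?k ! p = ?l ! p" "(?k ! n, ?l ! n) \<in> ?o" by blast
    have "\<not> i < j"
    proof
      assume "i < j"
      \<comment> \<open>At position \<open>i\<close> only the first tuple has a \<open>Some\<close>,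
        so agreement cannot extend past \<open>i\<close>. At n \<le> i the entries are two
        \<open>None\<close> or \<open>Some k\<close> against \<open>None\<close>, neither a strict
        increase.\<close>
      then have "\<not> i < n" using n(2) assms(1) by (auto simp: label_at_nth dest!: spec[of _ i])
      then show False using n(1,3) \<open>i < j\<close>
        by (auto simp: label_at_nth adjoin_least_order_def split: if_splits)
    qed
    moreover have "(k, l) \<in> s - Id" if "i = j"
      using n(1,3) that by (auto simp: label_at_nth adjoin_least_order_def split: if_splits)
    ultimately show "j < i \<or> i = j \<and> (k, l) \<in> s - Id" by auto
  next
    assume "j < i \<or> i = j \<and> (k, l) \<in> s - Id"
    then show "\<exists>n<m. (\<forall>p<n. ?k ! p = ?l ! p) \<and> (?k ! n, ?l ! n) \<in> ?o"
      using assms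
      by (intro exI[of _ j]) (auto simp: label_at_nth adjoin_least_order_def adjoin_least_def)
  qed
  finally show ?thesis .
qed

section \<open>Distinguished atoms of the multichain poset\<close>

theorem theorem3p4:
  fixes P :: "'a set" and r :: "'a rel"
    and \<Lambda> :: "'l set" and s :: "'l rel"
    and lab :: "'a \<times> 'a \<Rightarrow> 'l" and m :: nat
  assumes "finite P"
    and "bounded_poset P r"
    and "EL_labeling P r \<Lambda> s lab"
    and "m > 0"
  shows "EL_labeling (multichains P r m) (multichain_order P r m)
           (label_tuples \<Lambda> m) (label_tuple_order \<Lambda> s m) (product_labeling m lab)"
proof -
  let ?M = "multichains P r m" and ?R = "multichain_order P r m"
    and ?S = "label_tuple_order \<Lambda> s m" and ?L = "product_labeling m lab"
  have po: "partial_order_on P r" using assms(2) unfolding bounded_poset_def by blast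
  have spo: "partial_order_on \<Lambda> s" and lab: "\<And>e. e \<in> covers P r \<Longrightarrow> lab e \<in> \<Lambda>"
    using assms(3) unfolding EL_labeling_def edge_labeling_def by auto
  note D = partial_orderD[OF po]
  note iff = multichain_order_iff[OF po]
  obtain a where a: "rising_step P r s lab a" using EL_labeling_rising_step[OF assms(3)] .
  have aD: "(x, a x y) \<in> covers P r \<and> (a x y, y) \<in> r" if "(x, y) \<in> r" "x \<noteq> y" for x y
    using a that unfolding rising_step_def by auto
  have a_less: "(lab (x, a x y), lab (x, z)) \<in> s - Id"
    if "(x, z) \<in> covers P r" "(z, y) \<in> r" "z \<noteq> a x y" "(x, y) \<in> r" "x \<noteq> y" for x y z
    using a that unfolding rising_step_def by blast
  have a_rise: "(lab (x, z), lab (z, a z y)) \<in> s - Id \<longleftrightarrow> z = a x y"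
    if "(x, z) \<in> covers P r" "(z, y) \<in> r" "z \<noteq> y" "(x, y) \<in> r" "x \<noteq> y" for x y z
    using a that unfolding rising_step_def by blast
  have len: "length xs = m" if "xs \<in> ?M" for xs using that by (simp add: multichains_def)
  have lab_update: "?L (xs, xs[j := v]) = label_at m j (lab (xs ! j, v))"
    if "xs \<in> ?M" "j < m" "(xs ! j, v) \<in> covers P r" for xs j v
    using product_labeling_update[OF len[OF that(1)] that(2) coversD(4)[OF that(3)]] .
  have edge: "edge_labeling ?M ?R (label_tuples \<Lambda> m) ?S ?L"
    unfolding edge_labeling_def
  proof
    show "partial_order_on (label_tuples \<Lambda> m) ?S"
      unfolding label_tuple_order_def
      by (rule partial_order_on_lex_le[OF partial_order_on_adjoin_least[OF spo]])
    have "?L (xs, ys) \<in> label_tuples \<Lambda> m" if cov: "(xs, ys) \<in> covers ?M ?R" for xs ys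
    proof -
      obtain j v where "j < m" "(xs ! j, v) \<in> covers P r" "ys = xs[j := v]"
        using covers_multichainsE[OF po aD cov] by metis
      then show ?thesis using lab_update coversD(1)[OF cov] label_at_mem lab by metis
    qed
    then show "?L \<in> covers ?M ?R \<rightarrow> label_tuples \<Lambda> m" by auto
  qed
  \<comment> \<open>The largest differing index; the name shadows the list function.
    \<open>A\<close> raises that entry to the distinguished atom in \<open>P\<close>.\<close>
  define last where "last xs ys = (GREATEST j. j < m \<and> xs ! j \<noteq> ys ! j)" for xs ys :: "'a list"
  define A where "A xs ys = xs[last xs ys := a (xs ! last xs ys) (ys ! last xs ys)]" for xs ys
  have A_eq: "A xs ys = xs[j := a (xs ! j) (ys ! j)]"
    if "j < m" "xs ! j \<noteq> ys ! j" "\<And>i. j < i \<Longrightarrow> i < m \<Longrightarrow> xs ! i = ys ! i" for xs ys j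
  proof -
    have "last xs ys = j"
      unfolding last_def using that by (intro Greatest_equality) (auto simp: not_less[symmetric])
    then show ?thesis by (simp add: A_def)
  qed
  have "rising_step ?M ?R ?S ?L A"
    unfolding rising_step_def
  proof (intro allI impI)
    fix xs ys assume "(xs, ys) \<in> ?R - Id"
    then have xy: "(xs, ys) \<in> ?R" "xs \<noteq> ys" by auto
    then have X: "xs \<in> ?M" and Y: "ys \<in> ?M" and le: "\<And>i. i < m \<Longrightarrow> (xs ! i, ys ! i) \<in> r"
      by (auto simp: iff)
    obtain j where j: "j < m" "xs ! j \<noteq> ys ! j" "\<And>i. j < i \<Longrightarrow> i < m \<Longrightarrow> xs ! i = ys ! i"
      using last_difference[OF X Y xy(2)] by blast
    let ?v = "a (xs ! j) (ys ! j)"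
    have v: "(xs ! j, ?v) \<in> covers P r" "(?v, ys ! j) \<in> r"
      using aD[OF le[OF j(1)] j(2)] by auto
    note up = update_last_difference[OF po xy(1) j(1,3) coversD(3)[OF v(1)] v(2)]
    have A: "A xs ys = xs[j := ?v]" using A_eq j by blast
    have "(zs \<noteq> A xs ys \<longrightarrow> (?L (xs, A xs ys), ?L (xs, zs)) \<in> ?S - Id) \<and>
        (zs \<noteq> ys \<longrightarrow> ((?L (xs, zs), ?L (zs, A zs ys)) \<in> ?S - Id \<longleftrightarrow> zs = A xs ys))"
      if zs: "(xs, zs) \<in> covers ?M ?R" "(zs, ys) \<in> ?R" for zs
    proof -
      obtain i w where i: "i < m" "(xs ! i, w) \<in> covers P r" and zs_eq: "zs = xs[i := w]"
        using covers_multichainsE[OF po aD zs(1)] by metis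
      have Z: "zs \<in> ?M" using coversD(2)[OF zs(1)] .
      have zle: "(zs ! p, ys ! p) \<in> r" if "p < m" for p using zs(2) that by (simp add: iff)
      have w: "(w, ys ! i) \<in> r" using zle[OF i(1)] i(1) len[OF X] by (simp add: zs_eq)
      have "xs ! i \<noteq> ys ! i" using coversD(3,4)[OF i(2)] w D(4) by metis
      \<comment> \<open>The entry raised by a cover below \<open>ys\<close> is one where
        \<open>xs\<close> and \<open>ys\<close> differ, and \<open>j\<close> is the last of
        these.\<close>
      then have "i \<le> j" using j(3) i(1) by (metis not_le)
      have Lx: "?L (xs, zs) = label_at m i (lab (xs ! i, w))"
        unfolding zs_eq by (rule lab_update[OF X i])
      have LA: "?L (xs, A xs ys) = label_at m j (lab (xs ! j, ?v))"
        unfolding A by (rule lab_update[OF X j(1) v(1)])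
      have inj: "zs = A xs ys \<longleftrightarrow> i = j \<and> w = ?v"
      proof
        assume eq: "zs = A xs ys"
        have "i = j"
        proof (rule ccontr)
          assume "i \<noteq> j"
          then have "zs ! i = xs ! i" using eq A by simp
          then show False using i len[OF X] coversD(4)[OF i(2)] by (simp add: zs_eq)
        qed
        then show "i = j \<and> w = ?v" using eq A i(1) len[OF X] by (metis zs_eq nth_list_update_eq)
      qed (simp add: A zs_eq)
      show ?thesis
      proof (intro conjI impI)
        assume "zs \<noteq> A xs ys"
        then have ne: "\<not> (i = j \<and> w = ?v)" using inj by simp
        have "i < j \<or> j = i \<and> (lab (xs ! j, ?v), lab (xs ! i, w)) \<in> s - Id"
        proof (cases "i = j")
          case True
          then show ?thesis
            using a_less[of "xs ! j" w "ys ! j"] i(2) w ne le[OF j(1)] j(2) by simp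
        next
          case False
          then show ?thesis using \<open>i \<le> j\<close> by simp
        qed
        then show "(?L (xs, A xs ys), ?L (xs, zs)) \<in> ?S - Id"
          unfolding Lx LA label_at_less_iff[OF j(1) i(1) lab[OF v(1)] lab[OF i(2)]] .
      next
        assume "zs \<noteq> ys"
        \<comment> \<open>The next distinguished step from \<open>zs\<close> raises entry
          \<open>k\<close>, so its label is supported at \<open>k\<close>.\<close>
        obtain k where k: "k < m" "zs ! k \<noteq> ys ! k" "\<And>p. k < p \<Longrightarrow> p < m \<Longrightarrow> zs ! p = ys ! p"
          using last_difference[OF Z Y \<open>zs \<noteq> ys\<close>] by blast
        let ?u = "a (zs ! k) (ys ! k)"
        have u: "(zs ! k, ?u) \<in> covers P r" using aD[OF zle[OF k(1)] k(2)] by blast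
        have Az: "A zs ys = zs[k := ?u]" using A_eq k by blast
        have Lz: "?L (zs, A zs ys) = label_at m k (lab (zs ! k, ?u))"
          unfolding Az by (rule lab_update[OF Z k(1) u])
        have zi: "zs ! i = w" using i(1) len[OF X] by (simp add: zs_eq)
        have zn: "zs ! p = xs ! p" if "p \<noteq> i" for p using that by (simp add: zs_eq)
        have "k \<le> j" using k j(3) zn \<open>i \<le> j\<close> by (metis not_le)
        have "(?L (xs, zs), ?L (zs, A zs ys)) \<in> ?S - Id \<longleftrightarrow>
            k < i \<or> i = k \<and> (lab (xs ! i, w), lab (zs ! k, ?u)) \<in> s - Id"
          unfolding Lx Lz by (rule label_at_less_iff[OF i(1) k(1) lab[OF i(2)] lab[OF u]])
        also have "\<dots> \<longleftrightarrow> i = j \<and> w = ?v"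
        proof (cases "i = j")
          case False
          \<comment> \<open>For i < j the entry at \<open>j\<close> is untouched and still differs
            from that of \<open>ys\<close>. So i < k, and the labels do not rise.\<close>
          then have "\<not> j > k" using k(3) j(1,2) zn by metis
          then show ?thesis using \<open>i \<le> j\<close> False by simp
        next
          case True
          show ?thesis
          proof (cases "w = ys ! j")
            case w_top: True
            \<comment> \<open>Position \<open>j\<close> is finished in one step:
              \<open>ys ! j\<close> is the only atom of its interval, and the next step happens at a
              smaller index, where labels are larger.\<close>
            have "w = ?v"
              using covers_eq[of "xs ! j" w P r ?v] i(2) v w_top \<open>i = j\<close> by auto
            moreover have "k < i" using \<open>k \<le> j\<close> k(2) zi w_top \<open>i = j\<close> by (metis le_neq_implies_less)
            ultimately show ?thesis using \<open>i = j\<close> by simp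
          next
            case w_less: False
            \<comment> \<open>Position \<open>j\<close> is unfinished, so both steps act there and
              the equivalence is the one in \<open>P\<close>.\<close>
            then have "\<not> k < j" using k(3)[of j] j(1) zi \<open>i = j\<close> by auto
            then have "k = j" using \<open>k \<le> j\<close> by simp
            then show ?thesis
              using a_rise[of "xs ! j" w "ys ! j"] i(2) w w_less le[OF j(1)] j(2) zi \<open>i = j\<close>
              by simp
          qed
        qed
        also have "\<dots> \<longleftrightarrow> zs = A xs ys" using inj by simp
        finally show "(?L (xs, zs), ?L (zs, A zs ys)) \<in> ?S - Id \<longleftrightarrow> zs = A xs ys" .
      qed
    qed
    moreover have "(xs, A xs ys) \<in> covers ?M ?R"
      unfolding A by (rule covers_multichains_update[OF po j(1) X up(1) v(1)])
    moreover have "(A xs ys, ys) \<in> ?R" unfolding A by (rule up(2))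
    ultimately show "(xs, A xs ys) \<in> covers ?M ?R \<and> (A xs ys, ys) \<in> ?R \<and>
        (\<forall>zs. (xs, zs) \<in> covers ?M ?R \<and> (zs, ys) \<in> ?R \<longrightarrow>
          (zs \<noteq> A xs ys \<longrightarrow> (?L (xs, A xs ys), ?L (xs, zs)) \<in> ?S - Id) \<and>
          (zs \<noteq> ys \<longrightarrow> ((?L (xs, zs), ?L (zs, A zs ys)) \<in> ?S - Id \<longleftrightarrow> zs = A xs ys)))"
      by blast
  qed
  then show ?thesis
    using rising_step_EL_labeling finite_multichains[OF assms(1)]
      bounded_poset_multichains[OF assms(1,2)] edge by blast
qed

end
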